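(* Let $k\in\mathbb{N}_+$ and let $\underline{\lambda}=(\lambda_1,\dots,\lambda_k)\in\mathbb{R}_+^k$. Assume that $k\ge 2$ and that $\sum_{i\in I}\lambda_i<1$ for every $I\subseteq[k]$ with $|I|\le k-2$. (i) If $\underline{\lambda}$ is fully critical-subcritical, then $f^*_\ell=\mathbf{1}[\ell=1]$ for every $\ell\in\mathbb{N}_+$. (ii) If $\underline{\lambda}$ is not fully critical-subcritical, then $f^*_\ell>0$ for every $\ell\in\mathbb{N}_+$.
   Context: Notation: $\mathbb{N}_+=\{1,2,\dots\}$, $\mathbb{R}_+=(0,\infty)$, $[k]=\{1,\dots,k\}$. For $\underline{\lambda}\in\mathbb{R}_+^k$ let $\lambda^{\setminus i}=\sum_{j\in[k]\setminus\{i\}}\lambda_j$. The vector $\underline{\lambda}$ is fully critical-subcritical if $\lambda^{\setminus i}\le 1$ for all $i\in[k]$. ECBP trees. $G_\infty=G_\infty(r)\sim\mathcal{G}_\infty(\underline{\lambda})$ denotes the random (possibly infinite) edge-colored tree with root $r$ generated recursively: given the tree up to generation $d$, each vertex $v$ in generation $d$ has $X_{v,i}\sim\mathrm{POI}(\lambda_i)$ children joined to it by an edge of color $i$ ($i\in[k]$), all these variables being conditionally independent. Write $v\stackrel{G_\infty^{\setminus i}}{\longleftrightarrow}w$ if the path between $v$ and $w$ contains no edge of color $i$, and $v\stackrel{G_\infty^{\setminus i}}{\longleftrightarrow}\infty$ if there is an infinite path starting at $v$ without edges of color $i$ all of whose vertices are descendants of $v$. The root $r$ and $v$ are $i$-avoiding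 friends if either $r\stackrel{G_\infty^{\setminus i}}{\longleftrightarrow}v$, or both $r\stackrel{G_\infty^{\setminus i}}{\longleftrightarrow}\infty$ and $v\stackrel{G_\infty^{\setminus i}}{\longleftrightarrow}\infty$. They are friends if they are $i$-avoiding friends for all $i\in[k]$. $\widetilde{\mathcal{C}}^*(r)$ is the set of friends of $r$ (it contains $r$), and $f^*_\ell=f^*_\ell(\underline{\lambda})=\mathbb{P}(|\widetilde{\mathcal{C}}^*(r)|=\ell)$ for $\ell\in\mathbb{N}_+$. *)

theory Defs
  imports "HOL-Probability.Probability"
begin

text \<open>
  The colour set $[k]$ is a finite type \<^typ>\<open>'k\<close> with $k = $ \<^term>\<open>CARD('k)\<close>, and a vector
  $\lambda$ of rates is an element of \<^typ>\<open>real ^ 'k\<close>.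
\<close>

definition rate_without :: "real ^ 'k::finite \<Rightarrow> 'k \<Rightarrow> real" where
  "rate_without lam i = (\<Sum>j \<in> UNIV - {i}. lam $ j)"

definition fully_critical_subcritical :: "real ^ 'k::finite \<Rightarrow> bool" where
  "fully_critical_subcritical lam \<longleftrightarrow> (\<forall>i. rate_without lam i \<le> 1)"

text \<open>
  Ulam--Harris encoding of the vertices: the root is the empty list, and \<open>v @ [(i, n)]\<close> is the
  \<open>n\<close>-th (counting from 0) child of \<open>v\<close> among those joined to \<open>v\<close> by an edge of colour \<open>i\<close>.
\<close>

type_synonym 'k vertex = "('k \<times> nat) list"

text \<open>
  An offspring configuration assigns to each pair \<open>(v, i)\<close> the number $X_{v,i}$ of colour-\<open>i\<close>
  children of \<open>v\<close>. Numbers are assigned to all potential vertices \<open>v\<close>, whether or not they occur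
  in the tree; as all of them are independent, the values at the vertices of generation $d$ are,
  given the tree up to generation $d$, independent with the prescribed Poisson laws.
\<close>

type_synonym 'k offspring = "'k vertex \<times> 'k \<Rightarrow> nat"

definition ecbp :: "real ^ 'k::finite \<Rightarrow> 'k offspring measure" where
  "ecbp lam = (\<Pi>\<^sub>M (v, i) \<in> UNIV. measure_pmf (poisson_pmf (lam $ i)))"

inductive_set tree :: "'k offspring \<Rightarrow> 'k vertex set" for X :: "'k offspring" where
  root: "[] \<in> tree X"
| child: "v \<in> tree X \<Longrightarrow> n < X (v, i) \<Longrightarrow> v @ [(i, n)] \<in> tree X"

definition edge :: "'k offspring \<Rightarrow> 'k \<Rightarrow> 'k vertex \<Rightarrow> 'k vertex \<Rightarrow> bool" where
  "edge X i v w \<longleftrightarrow> v \<in> tree X \<and> w \<in> tree X \<and>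
     (\<exists>n. w = v @ [(i, n)] \<or> v = w @ [(i, n)])"

definition avoiding_edge :: "'k offspring \<Rightarrow> 'k \<Rightarrow> 'k vertex \<Rightarrow> 'k vertex \<Rightarrow> bool" where
  "avoiding_edge X i v w \<longleftrightarrow> (\<exists>j. j \<noteq> i \<and> edge X j v w)"

text \<open>
  In a tree there is exactly one path between two given vertices, so ``the path between \<open>v\<close> and
  \<open>w\<close> has no edge of colour \<open>i\<close>'' is stated as the existence of a path with this property.
\<close>

definition avoiding_connected :: "'k offspring \<Rightarrow> 'k \<Rightarrow> 'k vertex \<Rightarrow> 'k vertex \<Rightarrow> bool" where
  "avoiding_connected X i v w \<longleftrightarrow>
     (\<exists>p. p \<noteq> [] \<and> hd p = v \<and> last p = w \<and> set p \<subseteq> tree X \<and> distinct p \<and>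
          successively (avoiding_edge X i) p)"

text \<open>
  The vertex \<open>u\<close> is a descendant of \<open>v\<close> (or \<open>v\<close> itself) iff \<open>v\<close> is an initial segment of \<open>u\<close>.
\<close>

definition avoiding_infinite :: "'k offspring \<Rightarrow> 'k \<Rightarrow> 'k vertex \<Rightarrow> bool" where
  "avoiding_infinite X i v \<longleftrightarrow>
     (\<exists>p :: nat \<Rightarrow> 'k vertex. p 0 = v \<and> inj p \<and>
        (\<forall>m. p m \<in> tree X \<and> (\<exists>u. p m = v @ u) \<and> avoiding_edge X i (p m) (p (Suc m))))"

definition avoiding_friends :: "'k offspring \<Rightarrow> 'k \<Rightarrow> 'k vertex \<Rightarrow> 'k vertex \<Rightarrow> bool" where
  "avoiding_friends X i v w \<longleftrightarrow>
     avoiding_connected X i v w \<or> (avoiding_infinite X i v \<and> avoiding_infinite X i w)"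

definition friends_of_root :: "'k offspring \<Rightarrow> 'k vertex set" where
  "friends_of_root X = {v \<in> tree X. \<forall>i. avoiding_friends X i [] v}"

definition f_star :: "real ^ 'k::finite \<Rightarrow> nat \<Rightarrow> real" where
  "f_star lam l = measure (ecbp lam)
     {X \<in> space (ecbp lam). finite (friends_of_root X) \<and> card (friends_of_root X) = l}"

end

theory Submission
  imports Defs "HOL-Library.Sublist"
begin

text \<open>
  Everything rests on one description of the friends of the root. Call a configuration immortal
  for the colour \<open>i\<close> if the subtree of the root that avoids \<open>i\<close> has vertices in all generations.
  The path from the root to \<open>v\<close> avoids \<open>i\<close> iff \<open>i\<close> is not among the colours of the address of
  \<open>v\<close>, and by Koenig's lemma infinite avoiding paths are the same as immortality. So \<open>v\<close> is a
  friend iff, for every colour \<open>i\<close> on the path to \<open>v\<close>, both the root and the subtree of \<open>v\<close> are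
  immortal for \<open>i\<close> (\<open>friends_of_root_eq\<close>).

  The subtree avoiding \<open>i\<close> is a Galton--Watson tree with Poisson offspring of mean
  \<open>L = rate_without lam i\<close>, so the survival probabilities satisfy \<open>s' = 1 - exp (- L * s)\<close> from one
  generation to the next (\<open>prob_survives_Suc\<close>), and immortality has positive probability iff
  \<open>L > 1\<close>. If \<open>L \<le> 1\<close> for all colours, then almost surely the root is immortal for no colour,
  and its only friend is itself.

  If \<open>L > 1\<close> for the colour \<open>i\<close>, an explicit event of positive probability has exactly \<open>l\<close>
  friends (\<open>friends_of_root_star\<close>). The root has \<open>l - 1\<close> children of colour \<open>i\<close>. Below
  the root, and below each of these children, hangs a path whose edges run through all colours other
  than \<open>i\<close>, without further branching, and at the end of each path the subtree is
  immortal for \<open>i\<close>. Then the root and these children are immortal for \<open>i\<close>, whereas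
  for \<open>j \<noteq> i\<close> the component of the root that avoids \<open>j\<close> is cut off on every path before its end,
  and hence finite. So friends can only be reached by edges of colour \<open>i\<close>: these are the root and
  its \<open>l - 1\<close> children. The probability of the event is a product of Poisson weights and
  survival probabilities, by the branching property.
\<close>

section \<open>The offspring configurations as a product space\<close>

abbreviation offspring_law :: "real ^ 'k::finite \<Rightarrow> 'k vertex \<times> 'k \<Rightarrow> nat measure" where
  "offspring_law lam x \<equiv> measure_pmf (poisson_pmf (lam $ snd x))"

lemma ecbp_eq_PiM: "ecbp lam = PiM UNIV (offspring_law lam)"
  unfolding ecbp_def by (intro PiM_cong) (auto split: prod.splits)

lemma space_ecbp [simp]: "space (ecbp lam) = UNIV"
  by (simp add: ecbp_eq_PiM space_PiM)

lemma prob_space_ecbp: "prob_space (ecbp lam)"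
  unfolding ecbp_eq_PiM by (intro prob_space_PiM prob_space_measure_pmf)

lemma measurable_offspring_component:
  assumes "x \<in> K"
  shows "(\<lambda>X. X x) \<in> measurable (PiM K (offspring_law lam)) (count_space UNIV)"
  using measurable_component_singleton[OF assms, of "offspring_law lam"] by simp

lemma measurable_coordinate [measurable]:
  "(\<lambda>X. X x) \<in> measurable (ecbp lam) (count_space UNIV)"
  unfolding ecbp_eq_PiM by (rule measurable_offspring_component) simp

lemma prob_coordinate:
  "measure (ecbp lam) {X. X (v, i) = a} = pmf (poisson_pmf (lam $ i)) a"
proof -
  have "measure_pmf (poisson_pmf (lam $ i)) =
          distr (ecbp lam) (offspring_law lam (v, i)) (\<lambda>X. X (v, i))"
    unfolding ecbp_eq_PiM
    using distr_PiM_component[of UNIV "offspring_law lam" "(v, i)"]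
    by (simp add: prob_space_measure_pmf)
  then have "measure (measure_pmf (poisson_pmf (lam $ i))) {a} =
      measure (distr (ecbp lam) (offspring_law lam (v, i)) (\<lambda>X. X (v, i))) {a}"
    by simp
  also have "\<dots> = measure (ecbp lam) {X. X (v, i) = a}"
    by (subst measure_distr)
       (auto simp: vimage_def)
  finally show ?thesis by (simp add: measure_pmf_single)
qed

lemma indep_coordinates:
  "prob_space.indep_vars (ecbp lam) (offspring_law lam) (\<lambda>x X. X x) UNIV"
proof -
  interpret prob_space "ecbp lam" by (rule prob_space_ecbp)
  have rv: "random_variable (offspring_law lam x) (\<lambda>X. X x)" for x
    unfolding ecbp_eq_PiM by (rule measurable_component_singleton) simp
  have comp: "distr (ecbp lam) (offspring_law lam x) (\<lambda>X. X x) = offspring_law lam x" for x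
    unfolding ecbp_eq_PiM by (rule distr_PiM_component) (auto simp: prob_space_measure_pmf)
  have "distr (ecbp lam) (PiM UNIV (offspring_law lam)) (\<lambda>X. X) = ecbp lam"
    by (rule distr_id2) (simp add: ecbp_eq_PiM)
  then show ?thesis
    by (subst indep_vars_iff_distr_eq_PiM) (auto simp: rv comp restrict_UNIV ecbp_eq_PiM[symmetric])
qed

text \<open>
  The form of independence used throughout. Restricting a configuration to a block \<open>K j\<close> gives
  independent random variables; an event that only looks at the block is a function of this
  restriction, as can be seen by padding the restricted configuration with zeros.
\<close>

lemma prob_Inter_disjoint_blocks:
  fixes lam :: "real ^ 'k::finite" and A :: "'j \<Rightarrow> 'k offspring set"
  assumes fin: "finite J"
    and meas: "\<And>j. j \<in> J \<Longrightarrow> A j \<in> sets (ecbp lam)"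
    and disj: "disjoint_family_on K J"
    and dep: "\<And>j X Y. j \<in> J \<Longrightarrow> X \<in> A j \<Longrightarrow> (\<And>x. x \<in> K j \<Longrightarrow> X x = Y x) \<Longrightarrow> Y \<in> A j"
  shows "measure (ecbp lam) (\<Inter>j\<in>J. A j) = (\<Prod>j\<in>J. measure (ecbp lam) (A j))"
proof (cases "J = {}")
  case True
  interpret prob_space "ecbp lam" by (rule prob_space_ecbp)
  show ?thesis using True prob_space by simp
next
  case False
  interpret prob_space "ecbp lam" by (rule prob_space_ecbp)
  define pad :: "'j \<Rightarrow> 'k offspring \<Rightarrow> 'k offspring"
    where "pad j Y = (\<lambda>x. if x \<in> K j then Y x else 0)" for j Y
  define B where "B j = pad j -` A j \<inter> space (PiM (K j) (offspring_law lam))" for j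
  have "pad j \<in> measurable (PiM (K j) (offspring_law lam)) (ecbp lam)" for j
    unfolding pad_def ecbp_eq_PiM
  proof (rule measurable_PiM_single')
    fix x :: "'k vertex \<times> 'k"
    show "(\<lambda>Y. if x \<in> K j then Y x else 0)
        \<in> measurable (PiM (K j) (offspring_law lam)) (offspring_law lam x)"
      by (cases "x \<in> K j") (auto intro!: measurable_offspring_component)
  qed auto
  then have B: "B j \<in> sets (PiM (K j) (offspring_law lam))" if "j \<in> J" for j
    using meas[OF that] unfolding B_def by (rule measurable_sets)
  have eq: "(\<lambda>X. restrict X (K j)) -` B j \<inter> space (ecbp lam) = A j" if "j \<in> J" for j
  proof -
    have "pad j (restrict X (K j)) \<in> A j \<longleftrightarrow> X \<in> A j" for X
      using dep[OF that, of X "pad j (restrict X (K j))"]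
        dep[OF that, of "pad j (restrict X (K j))" X]
      by (auto simp: pad_def)
    then show ?thesis by (auto simp: B_def space_PiM)
  qed
  have "indep_vars (\<lambda>j. PiM (K j) (offspring_law lam)) (\<lambda>j X. restrict (\<lambda>x. X x) (K j)) J"
    by (rule indep_vars_restrict[OF indep_coordinates _ disj]) simp
  from indep_varsD_finite[OF this False fin B] show ?thesis
    using eq by (simp cong: INF_cong prod.cong)
qed

definition subtree :: "'k vertex \<Rightarrow> 'k offspring \<Rightarrow> 'k offspring" where
  "subtree v X = (\<lambda>(u, i). X (v @ u, i))"

lemma subtree_apply [simp]: "subtree v X (u, i) = X (v @ u, i)"
  by (simp add: subtree_def)

lemma subtree_Nil [simp]: "subtree [] X = X"
  by (simp add: subtree_def)

lemma subtree_subtree [simp]: "subtree w (subtree v X) = subtree (v @ w) X"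
  by (auto simp: subtree_def)

lemma measurable_subtree [measurable]: "subtree v \<in> measurable (ecbp lam) (ecbp lam)"
  unfolding subtree_def ecbp_eq_PiM
  by (rule measurable_PiM_single')
     (auto simp: split_beta intro!: measurable_offspring_component)

lemma distr_subtree: "distr (ecbp lam) (ecbp lam) (subtree v) = ecbp lam"
proof -
  have "distr (PiM UNIV (offspring_law lam))
      (PiM UNIV (\<lambda>x. offspring_law lam (map_prod ((@) v) id x)))
      (\<lambda>X. \<lambda>x\<in>UNIV. X (map_prod ((@) v) id x)) =
      PiM UNIV (\<lambda>x. offspring_law lam (map_prod ((@) v) id x))"
    by (rule distr_PiM_reindex) (auto simp: prob_space_measure_pmf inj_on_def)
  moreover have "(\<lambda>X. \<lambda>x\<in>UNIV. X (map_prod ((@) v) id x)) = subtree v"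
    by (auto simp: subtree_def fun_eq_iff)
  moreover have "PiM UNIV (\<lambda>x. offspring_law lam (map_prod ((@) v) id x)) = ecbp lam"
    by (simp add: ecbp_eq_PiM)
  ultimately show ?thesis by (simp add: ecbp_eq_PiM)
qed

lemma prob_subtree:
  assumes "A \<in> sets (ecbp lam)"
  shows "measure (ecbp lam) {X. subtree v X \<in> A} = measure (ecbp lam) A"
proof -
  have "measure (ecbp lam) A = measure (distr (ecbp lam) (ecbp lam) (subtree v)) A"
    by (simp add: distr_subtree)
  also have "\<dots> = measure (ecbp lam) {X. subtree v X \<in> A}"
    using assms by (subst measure_distr) (auto simp: vimage_def)
  finally show ?thesis by simp
qed

lemma sets_subtree:
  assumes "A \<in> sets (ecbp lam)"
  shows "{X. subtree v X \<in> A} \<in> sets (ecbp lam)"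
  using measurable_sets[OF measurable_subtree assms, of v] by (simp add: vimage_def)

text \<open>
  The branching property: the numbers of children of the root and the subtrees hanging off the
  potential children \<open>e\<close> are independent, since they are read off from disjoint blocks of
  coordinates.
\<close>

lemma branching:
  fixes lam :: "real ^ 'k::finite" and C :: "('k \<times> nat) set"
  assumes fin: "finite C" and A: "\<And>e. e \<in> C \<Longrightarrow> A e \<in> sets (ecbp lam)"
  shows "measure (ecbp lam) {X. (\<forall>i\<in>I. X ([], i) = a i) \<and> (\<forall>e\<in>C. subtree [e] X \<in> A e)} =
     (\<Prod>i\<in>I. pmf (poisson_pmf (lam $ i)) (a i)) * (\<Prod>e\<in>C. measure (ecbp lam) (A e))"
proof -
  define E where "E = case_sum (\<lambda>i. {X :: 'k offspring. X ([], i) = a i})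
    (\<lambda>e. {X. subtree [e] X \<in> A e})"
  define K :: "'k + 'k \<times> nat \<Rightarrow> ('k vertex \<times> 'k) set"
    where "K = case_sum (\<lambda>i. {([], i)}) (\<lambda>e. {(v, i). \<exists>u. v = e # u})"
  have "measure (ecbp lam) (\<Inter>j\<in>I <+> C. E j) = (\<Prod>j\<in>I <+> C. measure (ecbp lam) (E j))"
  proof (rule prob_Inter_disjoint_blocks)
    show "finite (I <+> C)" using fin by simp
    show "E j \<in> sets (ecbp lam)" if "j \<in> I <+> C" for j
    proof (cases j)
      case (Inl i)
      have "Measurable.pred (ecbp lam) (\<lambda>X. X ([], i) = a i)" by measurable
      then show ?thesis using Inl by (simp add: E_def pred_def)
    next
      case (Inr e)
      then show ?thesis using that A[of e] by (auto simp: E_def intro!: sets_subtree)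
    qed
    show "disjoint_family_on K (I <+> C)"
      by (auto simp: disjoint_family_on_def K_def)
  next
    fix j and X Y :: "'k offspring"
    assume "j \<in> I <+> C" "X \<in> E j" and eq: "\<And>x. x \<in> K j \<Longrightarrow> X x = Y x"
    show "Y \<in> E j"
    proof (cases j)
      case (Inl i)
      then show ?thesis using \<open>X \<in> E j\<close> eq[of "([], i)"] by (simp add: E_def K_def)
    next
      case (Inr e)
      have "subtree [e] X = subtree [e] Y"
        using eq Inr by (auto simp: subtree_def K_def)
      then show ?thesis using \<open>X \<in> E j\<close> Inr by (simp add: E_def)
    qed
  qed
  also have "(\<Inter>j\<in>I <+> C. E j) =
      {X. (\<forall>i\<in>I. X ([], i) = a i) \<and> (\<forall>e\<in>C. subtree [e] X \<in> A e)}"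
    by (auto simp: E_def Plus_def ball_Un)
  also have "(\<Prod>j\<in>I <+> C. measure (ecbp lam) (E j)) =
      (\<Prod>i\<in>I. measure (ecbp lam) (E (Inl i))) * (\<Prod>e\<in>C. measure (ecbp lam) (E (Inr e)))"
    using fin by (subst prod.Plus) simp_all
  also have "\<dots> = (\<Prod>i\<in>I. pmf (poisson_pmf (lam $ i)) (a i)) *
      (\<Prod>e\<in>C. measure (ecbp lam) (A e))"
    using A by (simp add: E_def prob_coordinate prob_subtree cong: prod.cong)
  finally show ?thesis .
qed

lemma branching_pos:
  fixes lam :: "real ^ 'k::finite" and C :: "('k \<times> nat) set"
  assumes pos: "\<forall>i. lam $ i > 0" and fin: "finite C"
    and A: "\<And>e. e \<in> C \<Longrightarrow> A e \<in> sets (ecbp lam)"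
    and A_pos: "\<And>e. e \<in> C \<Longrightarrow> measure (ecbp lam) (A e) > 0"
  shows "measure (ecbp lam) {X. (\<forall>i. X ([], i) = a i) \<and> (\<forall>e\<in>C. subtree [e] X \<in> A e)} > 0"
  using branching[of C A lam UNIV a, OF fin A] pos A_pos
  by (auto intro!: mult_pos_pos prod_pos simp: less_imp_le)

section \<open>Survival of the subtree that avoids a colour\<close>

fun survives :: "'k \<Rightarrow> nat \<Rightarrow> 'k offspring \<Rightarrow> bool" where
  "survives i 0 X = True"
| "survives i (Suc n) X = (\<exists>j m. j \<noteq> i \<and> m < X ([], j) \<and> survives i n (subtree [(j, m)] X))"

definition immortal :: "'k \<Rightarrow> 'k offspring \<Rightarrow> bool" where
  "immortal i X \<longleftrightarrow> (\<forall>n. survives i n X)"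

lemma pred_survives [measurable]:
  fixes lam :: "real ^ 'k::finite"
  shows "Measurable.pred (ecbp lam) (survives i n)"
proof (induction n)
  case (Suc n)
  note Suc [measurable]
  have [measurable]: "Measurable.pred (ecbp lam) (\<lambda>X. survives i n (subtree v X))" for v
    by (rule measurable_compose[OF measurable_subtree Suc])
  show ?case unfolding survives.simps by measurable
qed simp

lemma pred_immortal [measurable]: "Measurable.pred (ecbp lam) (immortal i)"
  unfolding immortal_def by measurable

lemma sets_survives: "{X. survives i n X} \<in> sets (ecbp lam)"
  using pred_survives[of i n lam] by (simp add: pred_def)

lemma sets_immortal: "{X. immortal i X} \<in> sets (ecbp lam)"
  using pred_immortal[of i lam] by (simp add: pred_def)

lemma survives_Suc_imp: "survives i (Suc n) X \<Longrightarrow> survives i n X"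
proof (induction n arbitrary: X)
  case (Suc n)
  then show ?case by (metis survives.simps(2))
qed simp

lemma survives_antimono: "m \<le> n \<Longrightarrow> survives i n X \<Longrightarrow> survives i m X"
  by (induction n rule: dec_induct) (blast dest: survives_Suc_imp)+

text \<open>
  This is the generating function of the Poisson law at \<open>1 - s\<close>, where \<open>s\<close> is the survival
  probability: given that there are \<open>a\<close> children of colour \<open>j\<close>, none of their subtrees survives
  with probability \<open>(1 - s) ^ a\<close>.
\<close>

lemma prob_no_surviving_child_of_colour:
  fixes lam :: "real ^ 'k::finite"
  assumes pos: "\<forall>i. lam $ i > 0"
  shows "measure (ecbp lam) {X. \<forall>m < X ([], j). \<not> survives i n (subtree [(j, m)] X)} =
    exp (- (lam $ j) * measure (ecbp lam) {X. survives i n X})"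
proof -
  interpret prob_space "ecbp lam" by (rule prob_space_ecbp)
  define q where "q = measure (ecbp lam) {X. \<not> survives i n X}"
  have q: "q = 1 - measure (ecbp lam) {X. survives i n X}"
    using prob_compl[OF sets_survives[of i n lam]] by (simp add: q_def set_diff_eq)
  have meas: "{X. \<not> survives i n X} \<in> sets (ecbp lam)"
    using sets.compl_sets[OF sets_survives[of i n lam]] by (simp add: set_diff_eq)
  define E where "E a = {X. X ([], j) = a \<and>
    (\<forall>m < a. \<not> survives i n (subtree [(j, m)] X))}" for a
  have E_meas: "E a \<in> sets (ecbp lam)" for a
  proof -
    have [measurable]: "Measurable.pred (ecbp lam) (\<lambda>X. survives i n (subtree v X))" for v
      by (rule measurable_compose[OF measurable_subtree pred_survives])
    have "Measurable.pred (ecbp lam) (\<lambda>X. X ([], j) = a \<and>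
        (\<forall>m < a. \<not> survives i n (subtree [(j, m)] X)))" by measurable
    then show ?thesis by (simp add: pred_def E_def)
  qed
  have E_prob: "prob (E a) = exp (- (lam $ j)) * ((lam $ j * q) ^ a /\<^sub>R fact a)" for a
  proof -
    have "prob (E a) = measure (ecbp lam) {X. (\<forall>i\<in>{j}. X ([], i) = a) \<and>
        (\<forall>e\<in>Pair j ` {..<a}. subtree [e] X \<in> {X. \<not> survives i n X})}"
      by (intro arg_cong[where f = prob]) (auto simp: E_def)
    also have "\<dots> = pmf (poisson_pmf (lam $ j)) a * q ^ a"
      using meas by (subst branching) (auto simp: q_def card_image inj_on_def)
    also have "\<dots> = exp (- (lam $ j)) * ((lam $ j * q) ^ a /\<^sub>R fact a)"
      using pos by (simp add: less_imp_le power_mult_distrib divide_inverse ac_simps)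
    finally show ?thesis .
  qed
  have "(\<lambda>a. prob (E a)) sums prob (\<Union>a. E a)"
    using E_meas by (intro finite_measure_UNION) (auto simp: disjoint_family_on_def E_def)
  moreover have "(\<lambda>a. prob (E a)) sums (exp (- (lam $ j)) * exp (lam $ j * q))"
    unfolding E_prob by (intro sums_mult exp_converges)
  moreover have "(\<Union>a. E a) = {X. \<forall>m < X ([], j). \<not> survives i n (subtree [(j, m)] X)}"
    by (auto simp: E_def)
  ultimately have "prob {X. \<forall>m < X ([], j). \<not> survives i n (subtree [(j, m)] X)} =
      exp (- (lam $ j)) * exp (lam $ j * q)"
    using sums_unique2 by metis
  also have "\<dots> = exp (- (lam $ j) * measure (ecbp lam) {X. survives i n X})"
    by (simp add: q exp_add[symmetric] algebra_simps)
  finally show ?thesis .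
qed

text \<open>
  The subtree of the root that avoids colour \<open>i\<close> is a Galton--Watson tree with offspring law
  Poisson of mean \<open>rate_without lam i\<close>: a sum of independent Poisson variables enters only
  through the product of the generating functions.
\<close>

lemma prob_survives_Suc:
  fixes lam :: "real ^ 'k::finite"
  assumes pos: "\<forall>i. lam $ i > 0"
  shows "measure (ecbp lam) {X. survives i (Suc n) X} =
    1 - exp (- rate_without lam i * measure (ecbp lam) {X. survives i n X})"
proof -
  interpret prob_space "ecbp lam" by (rule prob_space_ecbp)
  define D where "D j = {X. \<forall>m < X ([], j). \<not> survives i n (subtree [(j, m)] X)}" for j
  define K :: "'k \<Rightarrow> ('k vertex \<times> 'k) set"
    where "K j = insert ([], j) {(v, c). \<exists>m u. v = (j, m) # u}" for j
  have D_meas: "D j \<in> sets (ecbp lam)" for j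
  proof -
    have [measurable]: "Measurable.pred (ecbp lam) (\<lambda>X. survives i n (subtree v X))" for v
      by (rule measurable_compose[OF measurable_subtree pred_survives])
    have "Measurable.pred (ecbp lam)
        (\<lambda>X. \<forall>m. m < X ([], j) \<longrightarrow> \<not> survives i n (subtree [(j, m)] X))" by measurable
    then show ?thesis by (simp add: pred_def D_def)
  qed
  have "prob (\<Inter>j\<in>UNIV - {i}. D j) = (\<Prod>j\<in>UNIV - {i}. prob (D j))"
  proof (rule prob_Inter_disjoint_blocks)
    show "disjoint_family_on K (UNIV - {i})" by (auto simp: disjoint_family_on_def K_def)
  next
    fix j and X Y :: "'k offspring"
    assume "X \<in> D j" and eq: "\<And>x. x \<in> K j \<Longrightarrow> X x = Y x"
    have "subtree [(j, m)] X = subtree [(j, m)] Y" for m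
      using eq by (auto simp: subtree_def K_def)
    moreover have "X ([], j) = Y ([], j)" using eq by (simp add: K_def)
    ultimately show "Y \<in> D j" using \<open>X \<in> D j\<close> by (simp add: D_def)
  qed (auto simp: D_meas)
  also have "\<dots> = exp (- rate_without lam i * measure (ecbp lam) {X. survives i n X})"
    unfolding D_def prob_no_surviving_child_of_colour[OF pos] rate_without_def
    by (simp add: exp_sum[symmetric] sum_distrib_right sum_negf)
  also have "(\<Inter>j\<in>UNIV - {i}. D j) = UNIV - {X. survives i (Suc n) X}"
    by (auto simp: D_def)
  finally show ?thesis
    using prob_compl[OF sets_survives[of i "Suc n" lam]] by simp
qed

lemma prob_survives_tendsto:
  "(\<lambda>n. measure (ecbp lam) {X. survives i n X}) \<longlonglongrightarrow> measure (ecbp lam) {X. immortal i X}"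
proof -
  interpret prob_space "ecbp lam" by (rule prob_space_ecbp)
  have "(\<lambda>n. prob {X. survives i n X}) \<longlonglongrightarrow> prob (\<Inter>n. {X. survives i n X})"
    by (rule finite_Lim_measure_decseq)
       (auto simp: sets_survives decseq_def intro: survives_antimono)
  also have "(\<Inter>n. {X. survives i n X}) = {X. immortal i X}"
    by (auto simp: immortal_def)
  finally show ?thesis .
qed

text \<open>
  The survival probability \<open>s\<close> satisfies \<open>s = 1 - exp (- L * s)\<close> with \<open>L = rate_without lam i\<close>.
  For \<open>s > 0\<close> the right-hand side is strictly less than \<open>L * s\<close>, so \<open>L \<le> 1\<close> forces \<open>s = 0\<close>.
\<close>

lemma prob_immortal_eq_0:
  fixes lam :: "real ^ 'k::finite"
  assumes pos: "\<forall>i. lam $ i > 0" and le: "rate_without lam i \<le> 1"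
  shows "measure (ecbp lam) {X. immortal i X} = 0"
proof (rule ccontr)
  define s where "s = measure (ecbp lam) {X. immortal i X}"
  define L where "L = rate_without lam i"
  assume "measure (ecbp lam) {X. immortal i X} \<noteq> 0"
  then have s: "s > 0" by (simp add: s_def zero_less_measure_iff)
  note lim = prob_survives_tendsto[of lam i, folded s_def]
  have "(\<lambda>n. measure (ecbp lam) {X. survives i (Suc n) X}) \<longlonglongrightarrow> 1 - exp (- L * s)"
    unfolding prob_survives_Suc[OF pos] L_def by (intro tendsto_intros lim)
  then have fixpoint: "s = 1 - exp (- L * s)"
    using LIMSEQ_Suc[OF lim] LIMSEQ_unique by blast
  have "L * s \<noteq> 0" using fixpoint s by auto
  moreover have "1 + (- L * s) < exp (- L * s)" if "L * s \<noteq> 0"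
    using exp_ge_add_one_self[of "- L * s"] that exp_minus_greater[of "L * s"] by auto
  ultimately have "s < L * s" using fixpoint by linarith
  then show False using s le by (simp add: L_def)
qed

text \<open>
  Zero is always a fixed point of \<open>x \<mapsto> 1 - exp (- L * x)\<close>, so a lower bound has to come from the
  finite generations: for \<open>L > 1\<close> the derivative at zero exceeds one, hence the map sends some
  small \<open>x > 0\<close> to a value at least \<open>x\<close>, and \<open>x\<close> stays below all iterates started from one.
\<close>

lemma prob_immortal_pos:
  fixes lam :: "real ^ 'k::finite"
  assumes pos: "\<forall>i. lam $ i > 0" and gr: "rate_without lam i > 1"
  shows "measure (ecbp lam) {X. immortal i X} > 0"
proof -
  interpret prob_space "ecbp lam" by (rule prob_space_ecbp)
  define L where "L = rate_without lam i"
  have L: "L > 1" using gr by (simp add: L_def)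
  have "((\<lambda>x. 1 - exp (- L * x) - x) has_real_derivative L - 1) (at 0)"
    by (auto intro!: derivative_eq_intros)
  from DERIV_pos_inc_right[OF this] L obtain d where
    d: "d > 0" "\<And>h. 0 < h \<Longrightarrow> h < d \<Longrightarrow> 0 < 1 - exp (- L * h) - h" by auto
  \<comment> \<open>The bound by one makes \<open>x\<close> a lower bound in generation zero, which always survives.\<close>
  define x where "x = min (d / 2) 1"
  have "0 < x" "x < d" "x \<le> 1"
    using d(1) by (auto simp: x_def min_def)
  with d(2)[of x] have x: "0 < x" "x \<le> 1" "x \<le> 1 - exp (- L * x)" by auto
  have "x \<le> prob {X. survives i n X}" for n
  proof (induction n)
    case 0
    then show ?case using x prob_space by simp
  next
    case (Suc n)
    then have "exp (- L * prob {X. survives i n X}) \<le> exp (- L * x)"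
      using L by simp
    then have "x \<le> 1 - exp (- L * prob {X. survives i n X})" using x by linarith
    then show ?case unfolding prob_survives_Suc[OF pos] L_def .
  qed
  then have "x \<le> measure (ecbp lam) {X. immortal i X}"
    by (intro LIMSEQ_le_const[OF prob_survives_tendsto]) auto
  then show ?thesis using x by linarith
qed
section \<open>Friends of the root in terms of surviving subtrees\<close>

lemma tree_snoc: "v @ [(i, n)] \<in> tree X \<longleftrightarrow> v \<in> tree X \<and> n < X (v, i)"
proof
  assume "v @ [(i, n)] \<in> tree X"
  then show "v \<in> tree X \<and> n < X (v, i)" by (cases rule: tree.cases) auto
qed (auto intro: tree.child)

lemma tree_append: "v @ u \<in> tree X \<longleftrightarrow> v \<in> tree X \<and> u \<in> tree (subtree v X)"
proof (induction u rule: rev_induct)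
  case Nil
  then show ?case by (simp add: tree.root)
next
  case (snoc e u)
  obtain i n where e: "e = (i, n)" by (cases e)
  have "v @ u @ [e] \<in> tree X \<longleftrightarrow> v @ u \<in> tree X \<and> n < X (v @ u, i)"
    using tree_snoc[of "v @ u" i n X] by (simp add: e)
  then show ?case by (auto simp: snoc tree_snoc e)
qed

lemma tree_Cons: "(i, n) # u \<in> tree X \<longleftrightarrow> n < X ([], i) \<and> u \<in> tree (subtree [(i, n)] X)"
  using tree_append[of "[(i, n)]" u X] tree_snoc[of "[]" i n X] by (simp add: tree.root)

lemma pred_tree [measurable]: "Measurable.pred (ecbp lam) (\<lambda>X. v \<in> tree X)"
proof (induction v rule: rev_induct)
  case Nil
  then show ?case by (simp add: tree.root)
next
  case (snoc e v)
  note snoc [measurable]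
  obtain i n where e: "e = (i, n)" by (cases e)
  show ?case unfolding e tree_snoc by measurable
qed

lemma avoiding_edge_iff:
  "avoiding_edge X i v w \<longleftrightarrow> v \<in> tree X \<and> w \<in> tree X \<and>
     (\<exists>j n. j \<noteq> i \<and> (w = v @ [(j, n)] \<or> v = w @ [(j, n)]))"
  unfolding avoiding_edge_def edge_def by blast

text \<open>
  A step down appends a colour other than \<open>i\<close> to the address and a step up removes a colour, so a
  walk that avoids \<open>i\<close> cannot bring \<open>i\<close> into the address.
\<close>

lemma avoiding_walk_colours:
  assumes "successively (avoiding_edge X i) p" "p \<noteq> []" "i \<notin> fst ` set (hd p)"
  shows "i \<notin> fst ` set (last p)"
  using assms
proof (induction p rule: induct_list012)
  case (3 v w p)
  then have "i \<notin> fst ` set w" by (auto simp: avoiding_edge_iff)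
  with 3 show ?case by auto
qed auto

lemma avoiding_connected_root:
  assumes "v \<in> tree X"
  shows "avoiding_connected X i [] v \<longleftrightarrow> i \<notin> fst ` set v"
proof
  assume "avoiding_connected X i [] v"
  then obtain p where "p \<noteq> []" "hd p = []" "last p = v" "successively (avoiding_edge X i) p"
    unfolding avoiding_connected_def by blast
  then show "i \<notin> fst ` set v" using avoiding_walk_colours[of X i p] by simp
next
  assume i: "i \<notin> fst ` set v"
  have "successively (avoiding_edge X i) (prefixes v)"
    using assms i
  proof (induction v rule: rev_induct)
    case (snoc e v)
    obtain j n where "e = (j, n)" by (cases e)
    with snoc show ?case
      by (auto simp: prefixes_snoc successively_append_iff avoiding_edge_iff tree_snoc)
  qed simp
  moreover have "hd (prefixes v) = []" by (cases v) simp_all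
  moreover have "set (prefixes v) \<subseteq> tree X"
    using assms by (auto simp: in_set_prefixes prefix_def tree_append)
  ultimately show "avoiding_connected X i [] v"
    unfolding avoiding_connected_def by (intro exI[of _ "prefixes v"]) auto
qed

text \<open>
  Koenig's lemma: a vertex has finitely many children, so the depths reached below them are
  bounded unless one child has descendants in every generation.
\<close>

lemma immortal_iff_immortal_child:
  fixes X :: "'k::finite offspring"
  shows "immortal i X \<longleftrightarrow>
    (\<exists>j m. j \<noteq> i \<and> m < X ([], j) \<and> immortal i (subtree [(j, m)] X))"
proof
  assume imm: "immortal i X"
  define C where "C = (SIGMA j:UNIV. {..<X ([], j)})"
  have C: "finite C" by (simp add: C_def)
  show "\<exists>j m. j \<noteq> i \<and> m < X ([], j) \<and> immortal i (subtree [(j, m)] X)"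
  proof (rule ccontr)
    assume no: "\<not> ?thesis"
    have "\<exists>n. fst e \<noteq> i \<longrightarrow> \<not> survives i n (subtree [e] X)" if "e \<in> C" for e
      using no that by (cases e) (auto simp: C_def immortal_def)
    then obtain N where N: "\<And>e. e \<in> C \<Longrightarrow> fst e \<noteq> i \<longrightarrow> \<not> survives i (N e) (subtree [e] X)"
      by metis
    define n where "n = Max (insert 0 (N ` C))"
    have le: "N e \<le> n" if "e \<in> C" for e
      using C that by (simp add: n_def)
    have "survives i (Suc n) X" using imm unfolding immortal_def by (rule spec)
    then obtain j m where jm: "j \<noteq> i" "m < X ([], j)" "survives i n (subtree [(j, m)] X)"
      by auto
    then have "(j, m) \<in> C" by (simp add: C_def)
    with N[of "(j, m)"] le[of "(j, m)"] jm show False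
      using survives_antimono[of "N (j, m)" n i "subtree [(j, m)] X"] by simp
  qed
next
  assume "\<exists>j m. j \<noteq> i \<and> m < X ([], j) \<and> immortal i (subtree [(j, m)] X)"
  then have "survives i n X" for n by (cases n) (auto simp: immortal_def)
  then show "immortal i X" by (simp add: immortal_def)
qed

text \<open>
  An injective path that starts at \<open>v\<close> and stays among the descendants of \<open>v\<close> can never step back
  to a parent: the parent of the current vertex is the vertex it came from.
\<close>

lemma avoiding_infinite_iff_immortal:
  fixes X :: "'k::finite offspring"
  assumes v: "v \<in> tree X"
  shows "avoiding_infinite X i v \<longleftrightarrow> immortal i (subtree v X)"
proof
  assume "avoiding_infinite X i v"
  then obtain p where p: "p 0 = v" "inj p" "\<And>m. p m \<in> tree X" "\<And>m. \<exists>u. p m = v @ u"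
    "\<And>m. avoiding_edge X i (p m) (p (Suc m))"
    unfolding avoiding_infinite_def by blast
  have down: "\<exists>j n. j \<noteq> i \<and> p (Suc m) = p m @ [(j, n)]" for m
  proof (induction m)
    case 0
    obtain u where "p (Suc 0) = v @ u" using p(4) by blast
    then show ?case using p(5)[of 0] p(1) by (auto simp: avoiding_edge_iff)
  next
    case (Suc m)
    then obtain j n where step: "p (Suc m) = p m @ [(j, n)]" by blast
    have "p (Suc (Suc m)) \<noteq> p m" using p(2) by (auto dest: injD)
    then show ?case using p(5)[of "Suc m"] step by (auto simp: avoiding_edge_iff)
  qed
  have "survives i n (subtree (p m) X)" for n m
  proof (induction n arbitrary: m)
    case (Suc n)
    obtain j k where jk: "j \<noteq> i" "p (Suc m) = p m @ [(j, k)]" using down by blast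
    then have "k < X (p m, j)" using p(3)[of "Suc m"] by (simp add: tree_snoc)
    moreover have "survives i n (subtree (p m @ [(j, k)]) X)" using Suc[of "Suc m"] jk by simp
    ultimately show ?case using jk(1) by auto
  qed simp
  from this[of _ 0] show "immortal i (subtree v X)" by (simp add: immortal_def p(1))
next
  assume imm: "immortal i (subtree v X)"
  have "\<exists>f. \<forall>m. (length (f m) = m \<and> v @ f m \<in> tree X \<and> immortal i (subtree (v @ f m) X)) \<and>
      (\<exists>j n. j \<noteq> i \<and> f (Suc m) = f m @ [(j, n)])"
  proof (rule dependent_nat_choice, goal_cases)
    case 1
    show ?case using v imm by (intro exI[of _ "[]"]) simp
  next
    case (2 u m)
    then obtain j n where "j \<noteq> i" "n < X (v @ u, j)" "immortal i (subtree (v @ u @ [(j, n)]) X)"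
      using immortal_iff_immortal_child[of i "subtree (v @ u) X"] by auto
    then show ?case
      using 2 tree_snoc[of "v @ u" j n X] by (intro exI[of _ "u @ [(j, n)]"]) auto
  qed
  then obtain f where f: "\<And>m. length (f m) = m" "\<And>m. v @ f m \<in> tree X"
    "\<And>m. \<exists>j n. j \<noteq> i \<and> f (Suc m) = f m @ [(j, n)]"
    by blast
  have "inj (\<lambda>m. v @ f m)"
    by (rule injI) (metis f(1) same_append_eq)
  moreover have "f 0 = []" using f(1)[of 0] by simp
  moreover have "avoiding_edge X i (v @ f m) (v @ f (Suc m))" for m
  proof -
    obtain j n where "j \<noteq> i" "f (Suc m) = f m @ [(j, n)]" using f(3) by blast
    then show ?thesis
      unfolding avoiding_edge_iff using f(2)[of m] f(2)[of "Suc m"] by simp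
  qed
  ultimately have "(\<lambda>m. v @ f m) 0 = v \<and> inj (\<lambda>m. v @ f m) \<and>
      (\<forall>m. v @ f m \<in> tree X \<and> (\<exists>u. v @ f m = v @ u) \<and>
        avoiding_edge X i (v @ f m) (v @ f (Suc m)))"
    using f(2) by simp
  then show "avoiding_infinite X i v"
    unfolding avoiding_infinite_def by (rule exI[of _ "\<lambda>m. v @ f m"])
qed

text \<open>
  Only the colours on the path to \<open>v\<close> impose a condition, because for any other colour the path
  itself is an avoiding path. For \<open>v = []\<close> no condition is left.
\<close>

lemma friends_of_root_eq:
  fixes X :: "'k::finite offspring"
  shows "friends_of_root X = {v \<in> tree X. \<forall>i. i \<in> fst ` set v \<longrightarrow>
    immortal i X \<and> immortal i (subtree v X)}"
proof -
  have "avoiding_friends X i [] v \<longleftrightarrow>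
      (i \<in> fst ` set v \<longrightarrow> immortal i X \<and> immortal i (subtree v X))" if "v \<in> tree X" for i v
    unfolding avoiding_friends_def avoiding_connected_root[OF that]
      avoiding_infinite_iff_immortal[OF that] avoiding_infinite_iff_immortal[OF tree.root]
      subtree_Nil by blast
  then show ?thesis
    unfolding friends_of_root_def by (intro Collect_cong conj_cong refl) simp
qed

text \<open>
  There are only countably many finite sets of vertices, so the event splits into countably many
  events that prescribe the set of friends.
\<close>

lemma sets_card_friends:
  fixes lam :: "real ^ 'k::finite"
  shows "{X. finite (friends_of_root X) \<and> card (friends_of_root X) = l} \<in> sets (ecbp lam)"
proof -
  have "{X. friends_of_root X = S} \<in> sets (ecbp lam)" for S :: "'k vertex set"
  proof -
    have [measurable]: "Measurable.pred (ecbp lam) (\<lambda>X. immortal i (subtree v X))" for i v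
      by (rule measurable_compose[OF measurable_subtree pred_immortal])
    have "Measurable.pred (ecbp lam) (\<lambda>X. \<forall>v. v \<in> S \<longleftrightarrow> (v \<in> tree X \<and>
        (\<forall>i. i \<in> fst ` set v \<longrightarrow> immortal i X \<and> immortal i (subtree v X))))"
      by measurable
    moreover have "friends_of_root X = S \<longleftrightarrow> (\<forall>v. v \<in> S \<longleftrightarrow> (v \<in> tree X \<and>
        (\<forall>i. i \<in> fst ` set v \<longrightarrow> immortal i X \<and> immortal i (subtree v X))))" for X
      unfolding friends_of_root_eq by blast
    ultimately show ?thesis by (simp add: pred_def)
  qed
  moreover have "countable {S :: 'k vertex set. finite S \<and> card S = l}"
    by (rule countable_subset[OF _ countable_Collect_finite]) auto
  ultimately have "(\<Union>S\<in>{S. finite S \<and> card S = l}. {X. friends_of_root X = S}) \<in> sets (ecbp lam)"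
    by (intro sets.countable_UN'') auto
  also have "(\<Union>S\<in>{S. finite S \<and> card S = l}. {X. friends_of_root X = S}) =
      {X. finite (friends_of_root X) \<and> card (friends_of_root X) = l}"
    by auto
  finally show ?thesis .
qed

section \<open>The fully critical-subcritical case\<close>

lemma friends_of_root_if_all_mortal:
  fixes X :: "'k::finite offspring"
  assumes "\<forall>i. \<not> immortal i X"
  shows "friends_of_root X = {[]}"
  using assms tree.root[of X] by (auto simp: friends_of_root_eq)

lemma f_star_critical_subcritical:
  fixes lam :: "real ^ 'k::finite"
  assumes pos: "\<forall>i. lam $ i > 0" and sub: "fully_critical_subcritical lam"
  shows "f_star lam l = (if l = 1 then 1 else 0)"
proof -
  interpret prob_space "ecbp lam" by (rule prob_space_ecbp)
  have "AE X in ecbp lam. \<not> immortal i X" for i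
    using prob_Collect_eq_0[of "immortal i"] sets_immortal[of i lam] prob_immortal_eq_0[OF pos, of i]
      sub by (simp add: fully_critical_subcritical_def)
  then have "AE X in ecbp lam. \<forall>i. \<not> immortal i X" by (simp add: AE_all_countable)
  then have AE: "AE X in ecbp lam. friends_of_root X = {[]}"
    by eventually_elim (rule friends_of_root_if_all_mortal)
  show ?thesis
  proof (cases "l = 1")
    case True
    have "prob {X. finite (friends_of_root X) \<and> card (friends_of_root X) = l} = 1"
      unfolding prob_eq_1[OF sets_card_friends] using AE by eventually_elim (simp add: True)
    then show ?thesis by (simp add: f_star_def True)
  next
    case False
    have "prob {X. finite (friends_of_root X) \<and> card (friends_of_root X) = l} = 0"
      unfolding prob_eq_0[OF sets_card_friends] using AE by eventually_elim (use False in simp)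
    then show ?thesis using False by (simp add: f_star_def)
  qed
qed

section \<open>Prescribing the number of friends\<close>

text \<open>
  In a chain the tree starts as a bare path whose edges have the colours \<open>js\<close>, and the subtree at
  the end of the path is immortal for \<open>i\<close>.
\<close>

fun chain :: "'k \<Rightarrow> 'k list \<Rightarrow> 'k offspring \<Rightarrow> bool" where
  "chain i [] X = immortal i X"
| "chain i (j # js) X =
     ((\<forall>c. X ([], c) = (if c = j then 1 else 0)) \<and> chain i js (subtree [(j, 0)] X))"

lemma pred_chain [measurable]: "Measurable.pred (ecbp lam) (chain i js)"
proof (induction js)
  case (Cons j js)
  have [measurable]: "Measurable.pred (ecbp lam) (\<lambda>X. chain i js (subtree v X))" for v
    by (rule measurable_compose[OF measurable_subtree Cons])
  show ?case unfolding chain.simps by measurable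
qed simp

lemma sets_chain: "{X. chain i js X} \<in> sets (ecbp lam)"
  using pred_chain[of i js lam] by (simp add: pred_def)

lemma prob_chain_pos:
  fixes lam :: "real ^ 'k::finite"
  assumes pos: "\<forall>i. lam $ i > 0" and gr: "rate_without lam i > 1"
  shows "measure (ecbp lam) {X. chain i js X} > 0"
proof (induction js)
  case Nil
  then show ?case using prob_immortal_pos[OF pos gr] by simp
next
  case (Cons j js)
  show ?case
    using branching_pos[OF pos, of "{(j, 0)}" "\<lambda>_. {X. chain i js X}"
        "\<lambda>c. if c = j then 1 else 0"] sets_chain[of i js lam] Cons
    by simp
qed

lemma chain_immortal:
  fixes X :: "'k::finite offspring"
  assumes "chain i js X" "i \<notin> set js"
  shows "immortal i X"
  using assms
proof (induction js arbitrary: X)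
  case (Cons j js)
  then have "j \<noteq> i" "0 < X ([], j)" "immortal i (subtree [(j, 0)] X)" by auto
  then show ?case by (subst immortal_iff_immortal_child) blast
qed simp

text \<open>
  Every infinite path downwards starts with the bare path of the chain, and so uses all the colours
  of \<open>js\<close>.
\<close>

lemma chain_not_immortal:
  fixes X :: "'k::finite offspring"
  assumes "chain i js X" "j \<in> set js"
  shows "\<not> immortal j X"
  using assms
proof (induction js arbitrary: X)
  case (Cons c js)
  show ?case
  proof
    assume "immortal j X"
    then obtain c' m where "c' \<noteq> j" "m < X ([], c')" "immortal j (subtree [(c', m)] X)"
      using immortal_iff_immortal_child[of j X] by blast
    moreover from this Cons.prems have "c' = c" "m = 0" by (auto split: if_splits)
    ultimately show False using Cons by auto
  qed
qed simp

text \<open>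
  The root starts a chain of its own, through its single child of colour \<open>j\<close>; the children of
  colour \<open>i\<close> are the starting points of full chains. Friends other than these are excluded in two
  ways: the root is mortal for the colours other than \<open>i\<close>, and the children of colour \<open>i\<close> have no
  children of colour \<open>i\<close> themselves, as \<open>i\<close> is not the first colour of their chains.
\<close>

lemma friends_of_root_star:
  fixes X :: "'k::finite offspring"
  assumes colours: "set (j # js) = UNIV - {i}"
    and root: "\<forall>c. X ([], c) = (if c = i then q else if c = j then 1 else 0)"
    and leaf: "\<forall>m<q. chain i (j # js) (subtree [(i, m)] X)"
    and stem: "chain i js (subtree [(j, 0)] X)"
  shows "friends_of_root X = insert [] ((\<lambda>m. [(i, m)]) ` {..<q})"
proof -
  have ij: "i \<noteq> j" "i \<notin> set js" using colours by auto
  have leaf_immortal: "immortal i (subtree [(i, m)] X)" if "m < q" for m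
    using that leaf colours by (intro chain_immortal[of i "j # js"]) auto
  have imm: "immortal i X"
  proof -
    have "immortal i (subtree [(j, 0)] X)" by (rule chain_immortal[OF stem ij(2)])
    moreover have "0 < X ([], j)" using root ij by simp
    ultimately show ?thesis using ij(1) immortal_iff_immortal_child[of i X] by metis
  qed
  have mortal: "\<not> immortal c X" if "c \<noteq> i" for c
  proof
    assume "immortal c X"
    then obtain d m where d: "d \<noteq> c" "m < X ([], d)" "immortal c (subtree [(d, m)] X)"
      using immortal_iff_immortal_child[of c X] by blast
    have c: "c \<in> set (j # js)" using that colours by auto
    from d(2) root consider "d = i" "m < q" | "d = j" "m = 0"
      by (auto split: if_splits)
    then show False
    proof cases
      case 1
      then show False using chain_not_immortal[of i "j # js"] leaf c d(3) by blast
    next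
      case 2
      then show False using chain_not_immortal[OF stem, of c] c d by auto
    qed
  qed
  have "v \<in> insert [] ((\<lambda>m. [(i, m)]) ` {..<q})" if "v \<in> friends_of_root X" for v
  proof -
    have v: "v \<in> tree X" "fst ` set v \<subseteq> {i}"
      using that mortal by (auto simp: friends_of_root_eq)
    show ?thesis
    proof (cases v)
      case (Cons e u)
      then obtain m where e: "e = (i, m)" using v(2) by (cases e) auto
      have m: "m < q" and u: "u \<in> tree (subtree [(i, m)] X)"
        using v(1) root by (auto simp: Cons e tree_Cons)
      have "u = []"
      proof (cases u)
        case (Cons e' u')
        then obtain m' where "e' = (i, m')"
          using v(2) \<open>v = e # u\<close> by (cases e') auto
        then show ?thesis using u leaf m ij by (auto simp: Cons tree_Cons)
      qed
      then show ?thesis using Cons e m by simp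
    qed simp
  qed
  moreover have "[(i, m)] \<in> friends_of_root X" if "m < q" for m
    using that imm leaf_immortal root by (auto simp: friends_of_root_eq tree_Cons tree.root)
  moreover have "[] \<in> friends_of_root X" by (simp add: friends_of_root_eq tree.root)
  ultimately show ?thesis by auto
qed

lemma f_star_pos:
  fixes lam :: "real ^ 'k::finite"
  assumes pos: "\<forall>i. lam $ i > 0" and super: "\<not> fully_critical_subcritical lam" and l: "l \<ge> 1"
  shows "f_star lam l > 0"
proof -
  interpret prob_space "ecbp lam" by (rule prob_space_ecbp)
  obtain i where gr: "rate_without lam i > 1"
    using super by (auto simp: fully_critical_subcritical_def not_le)
  have "UNIV - {i} \<noteq> {}"
  proof
    assume "UNIV - {i} = {}"
    then have "rate_without lam i = 0" by (simp only: rate_without_def sum.empty)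
    with gr show False by simp
  qed
  moreover obtain cs where cs: "set cs = UNIV - {i}" using finite_list[of "UNIV - {i}"] by auto
  ultimately obtain j js where jjs: "set (j # js) = UNIV - {i}" by (cases cs) auto
  obtain q where q: "l = Suc q" using l by (cases l) auto
  \<comment> \<open>The root is itself one of the \<open>l\<close> friends, which leaves \<open>q = l - 1\<close> children of colour \<open>i\<close>.\<close>
  define C where "C = insert (j, 0) (Pair i ` {..<q})"
  define A where "A e = {X. chain i (if fst e = i then j # js else js) X}" for e :: "'k \<times> nat"
  define E where "E = {X. (\<forall>c. X ([], c) = (if c = i then q else if c = j then 1 else 0)) \<and>
      (\<forall>e\<in>C. subtree [e] X \<in> A e)}"
  have "prob E > 0"
    unfolding E_def
  proof (rule branching_pos[OF pos])
    show "prob (A e) > 0" for e unfolding A_def by (rule prob_chain_pos[OF pos gr])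
    show "A e \<in> events" for e unfolding A_def by (rule sets_chain)
  qed (simp add: C_def)
  also have "prob E \<le> f_star lam l"
    unfolding f_star_def
  proof (rule finite_measure_mono)
    show "E \<subseteq> {X \<in> space (ecbp lam). finite (friends_of_root X) \<and> card (friends_of_root X) = l}"
    proof
      fix X assume X: "X \<in> E"
      have "friends_of_root X = insert [] ((\<lambda>m. [(i, m)]) ` {..<q})"
      proof (rule friends_of_root_star[OF jjs])
        show "\<forall>c. X ([], c) = (if c = i then q else if c = j then 1 else 0)"
          using X by (simp add: E_def)
        show "\<forall>m<q. chain i (j # js) (subtree [(i, m)] X)"
          using X by (auto simp: E_def C_def A_def simp del: chain.simps)
        show "chain i js (subtree [(j, 0)] X)"
          using X jjs by (auto simp: E_def C_def A_def simp del: chain.simps)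
      qed
      moreover have "card (insert [] ((\<lambda>m. [(i, m)]) ` {..<q})) = l"
        by (subst card_insert_disjoint) (auto simp: q card_image inj_on_def)
      ultimately show "X \<in> {X \<in> space (ecbp lam). finite (friends_of_root X) \<and>
          card (friends_of_root X) = l}" by simp
    qed
  qed (use sets_card_friends in simp)
  finally show ?thesis .
qed

theorem proposition2p18:
  fixes lam :: "real ^ 'k::finite"
  assumes pos: "\<forall>i. lam $ i > 0"
    and k_ge_2: "CARD('k) \<ge> 2"
    and small_sums: "\<forall>I :: 'k set. card I \<le> CARD('k) - 2 \<longrightarrow> (\<Sum>i\<in>I. lam $ i) < 1"
  shows "(fully_critical_subcritical lam \<longrightarrow>
            (\<forall>l::nat. l \<ge> 1 \<longrightarrow> f_star lam l = (if l = 1 then 1 else 0))) \<and>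
         (\<not> fully_critical_subcritical lam \<longrightarrow>
            (\<forall>l::nat. l \<ge> 1 \<longrightarrow> f_star lam l > 0))"
  using f_star_critical_subcritical[OF pos] f_star_pos[OF pos] by blast

end
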